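(* Let $L_1,\ldots,L_n$ ($n\geq1$) be finite distributive lattices, $L=L_1\times\cdots\times L_n$ with the product order, with top $\top$ and bottom $\bot$. Let $\alpha^1_0,\ldots,\alpha^1_{n-1}$ be real numbers such that, for every function $v:L\to\mathbb{R}$, \[\sum_{i\in\mathcal{J}(L)}I^v(i)=v(\top)-v(\bot),\] where for a join-irreducible element $i=(\bot_1,\ldots,\bot_{j-1},i_0,\bot_{j+1},\ldots,\bot_n)$ of $L$ (with $i_0$ join-irreducible in $L_j$), \[I^v(i):=\sum_{x}\alpha^1_{h(x)}\,\big(v(x\vee i)-v(x)\big),\] the sum running over all $x\in L$ with $x_j=\underline{i_0}$ and $x_k\in\{\bot_k,\top_k\}$ for all $k\neq j$. Then \[\alpha^1_k=\frac{(n-1-k)!\,k!}{n!},\qquad k=0,\ldots,n-1.\]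
   Context: $\top_k,\bot_k$ denote top and bottom of $L_k$. An element of a lattice is join-irreducible if it is not the bottom and covers exactly one element. $\mathcal{J}(L)$ is the set of join-irreducible elements of $L$; these are exactly the elements with one coordinate $j$ equal to a join-irreducible element $i_0$ of $L_j$ and all other coordinates bottom. $\underline{i_0}$ denotes the unique element of $L_j$ covered by $i_0$. $h(x)$ is the number of coordinates $l$ of $x$ with $x_l=\top_l$.
   Formalization: The formal theorem additionally assumes that each L_k has at least two elements (bottom different from top); with a one-element factor the claim fails, e.g. for n=1 and L_1 a single point, α_0 is unconstrained. *)

theory Defs
  imports Complex_Main "HOL-Library.FuncSet" "HOL-Algebra.Lattice"
begin

locale finite_distributive_lattice = lattice L for L (structure) +
  assumes finite_carrier: "finite (carrier L)"
    and carrier_nonempty: "carrier L \<noteq> {}"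
    and meet_join_distrib:
      "\<lbrakk>x \<in> carrier L; y \<in> carrier L; z \<in> carrier L\<rbrakk>
        \<Longrightarrow> x \<sqinter> (y \<squnion> z) = (x \<sqinter> y) \<squnion> (x \<sqinter> z)"

definition covers :: "('a, 'b) gorder_scheme \<Rightarrow> 'a \<Rightarrow> 'a \<Rightarrow> bool" where
  "covers L x y \<longleftrightarrow> x \<in> carrier L \<and> y \<in> carrier L \<and> y \<sqsubset>\<^bsub>L\<^esub> x \<and>
     \<not> (\<exists>z \<in> carrier L. y \<sqsubset>\<^bsub>L\<^esub> z \<and> z \<sqsubset>\<^bsub>L\<^esub> x)"

definition join_irreducibles :: "('a, 'b) gorder_scheme \<Rightarrow> 'a set" where
  "join_irreducibles L = {x \<in> carrier L. x \<noteq> \<bottom>\<^bsub>L\<^esub> \<and> (\<exists>!y. covers L x y)}"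

definition lower_cover :: "('a, 'b) gorder_scheme \<Rightarrow> 'a \<Rightarrow> 'a" where
  "lower_cover L x = (THE y. covers L x y)"

text \<open>The product \<open>L\<^sub>1 \<times> \<dots> \<times> L\<^sub>n\<close>: its elements are the functions with \<open>x\<^sub>k \<in> L\<^sub>k\<close> for
  \<open>k \<in> {1..n}\<close> that are \<open>undefined\<close> at every other index.\<close>

definition prod_order :: "nat \<Rightarrow> (nat \<Rightarrow> 'a gorder) \<Rightarrow> (nat \<Rightarrow> 'a) gorder" where
  "prod_order n L =
     \<lparr> carrier = (\<Pi>\<^sub>E k\<in>{1..n}. carrier (L k)),
       eq = (=),
       le = (\<lambda>x y. \<forall>k\<in>{1..n}. x k \<sqsubseteq>\<^bsub>L k\<^esub> y k) \<rparr>"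

definition top_count :: "nat \<Rightarrow> (nat \<Rightarrow> 'a gorder) \<Rightarrow> (nat \<Rightarrow> 'a) \<Rightarrow> nat" where
  "top_count n L x = card {l \<in> {1..n}. x l = \<top>\<^bsub>L l\<^esub>}"

text \<open>For \<open>i = (\<bottom>\<^sub>1, \<dots>, i\<^sub>0, \<dots>, \<bottom>\<^sub>n)\<close> with \<open>i\<^sub>0\<close> join-irreducible at position \<open>j\<close>,
  \<open>axis n L i\<close> is \<open>j\<close>, so that \<open>i (axis n L i)\<close> is \<open>i\<^sub>0\<close>.\<close>

definition axis :: "nat \<Rightarrow> (nat \<Rightarrow> 'a gorder) \<Rightarrow> (nat \<Rightarrow> 'a) \<Rightarrow> nat" where
  "axis n L i = (THE j. j \<in> {1..n} \<and> i j \<in> join_irreducibles (L j) \<and>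
                   (\<forall>k\<in>{1..n} - {j}. i k = \<bottom>\<^bsub>L k\<^esub>))"

definition importance ::
  "nat \<Rightarrow> (nat \<Rightarrow> 'a gorder) \<Rightarrow> (nat \<Rightarrow> real) \<Rightarrow> ((nat \<Rightarrow> 'a) \<Rightarrow> real) \<Rightarrow> (nat \<Rightarrow> 'a) \<Rightarrow> real" where
  "importance n L \<alpha> v i =
     (let j = axis n L i in
      \<Sum>x \<in> {x \<in> carrier (prod_order n L).
               x j = lower_cover (L j) (i j) \<and>
               (\<forall>k\<in>{1..n} - {j}. x k \<in> {\<bottom>\<^bsub>L k\<^esub>, \<top>\<^bsub>L k\<^esub>})}.
        \<alpha> (top_count n L x) * (v (x \<squnion>\<^bsub>prod_order n L\<^esub> i) - v x))"

lemma axis_unique: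
  assumes "j \<in> {1..n}" "i j \<in> join_irreducibles (L j)"
    and "\<And>k. k \<in> {1..n} - {j} \<Longrightarrow> i k = \<bottom>\<^bsub>L k\<^esub>"
  shows "axis n L i = j"
  unfolding axis_def
proof (rule the_equality)
  show "j \<in> {1..n} \<and> i j \<in> join_irreducibles (L j) \<and> (\<forall>k\<in>{1..n} - {j}. i k = \<bottom>\<^bsub>L k\<^esub>)"
    using assms by blast
next
  fix j'
  assume "j' \<in> {1..n} \<and> i j' \<in> join_irreducibles (L j') \<and> (\<forall>k\<in>{1..n} - {j'}. i k = \<bottom>\<^bsub>L k\<^esub>)"
  then show "j' = j"
    using assms(3)[of j'] by (auto simp: join_irreducibles_def)
qed

end

theory Submission
  imports Defs
begin

text \<open>In a finite lattice let \<open>r\<close> be the fraction of join-irreducible elements below a given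
  element. It rises from \<open>0\<close> at the bottom to \<open>1\<close> at the top and makes the same jump across every
  join-irreducible element. For \<open>S \<subseteq> {1..n}\<close> test the efficiency identity on
  \<open>v x = (\<Prod>l\<in>S. r (x\<^sub>l)) * (\<Prod>l\<notin>S. 1 - r (x\<^sub>l))\<close>. For each join-irreducible element on axis \<open>j\<close>
  only the \<open>x\<close> that is top exactly on \<open>S - {j}\<close> contributes, so with \<open>m = |S| \<ge> 1\<close> the identity
  becomes \<open>m \<alpha>\<^bsub>m-1\<^esub> - (n - m) \<alpha>\<^bsub>m\<^esub> = [m = n]\<close>, which determines \<open>\<alpha>\<close> by descending recursion.\<close>

section \<open>Covers, join-irreducible elements and relative rank in a single factor\<close>

context finite_distributive_lattice
begin

text \<open>The meet and the join of the whole carrier, which is finite and nonempty, are its least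
  and greatest elements.\<close>

lemma bounded_lattice: "bounded_lattice L"
proof
  have "greatest L (\<Sqinter>(carrier L)) (Lower L (carrier L))"
    using finite_inf_greatest finite_carrier carrier_nonempty by blast
  then have "least L (\<Sqinter>(carrier L)) (carrier L)"
    by (auto simp: greatest_def least_def Lower_def)
  then show "\<exists>x. least L x (carrier L)" ..
  have "least L (\<Squnion>(carrier L)) (Upper L (carrier L))"
    using finite_sup_least finite_carrier carrier_nonempty by blast
  then have "greatest L (\<Squnion>(carrier L)) (carrier L)"
    by (auto simp: greatest_def least_def Upper_def)
  then show "\<exists>x. greatest L x (carrier L)" ..
qed

end

sublocale finite_distributive_lattice \<subseteq> bounded_lattice
  by (rule bounded_lattice)

context finite_distributive_lattice
begin

lemma lless_iff: "x \<sqsubset> y \<longleftrightarrow> x \<sqsubseteq> y \<and> x \<noteq> y"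
  by (simp add: lless_def eq_is_equal)

lemma coversD:
  assumes "covers L x y"
  shows "x \<in> carrier L" "y \<in> carrier L" "y \<sqsubseteq> x" "y \<noteq> x"
  using assms by (auto simp: covers_def lless_iff)

text \<open>A maximal element of the finite half-open interval from \<open>y\<close> up to, but
  excluding, \<open>x\<close> is covered by \<open>x\<close>.\<close>

lemma ex_cover_above:
  assumes "x \<in> carrier L" "y \<in> carrier L" "y \<sqsubset> x"
  shows "\<exists>c. covers L x c \<and> y \<sqsubseteq> c"
proof -
  define A where "A = {z \<in> carrier L. y \<sqsubseteq> z \<and> z \<sqsubset> x}"
  have "finite A" "y \<in> A"
    using assms finite_carrier by (auto simp: A_def)
  have "asymp_on A (\<sqsubset>)"
    by (rule asymp_onI) (auto simp: A_def lless_iff intro: le_antisym)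
  moreover have "transp_on A (\<sqsubset>)"
    unfolding A_def transp_on_def using lless_trans by blast
  ultimately obtain m where m: "m \<in> A" "\<And>z. z \<in> A \<Longrightarrow> z \<noteq> m \<Longrightarrow> \<not> m \<sqsubset> z"
    using Finite_Set.bex_max_element[of A "(\<sqsubset>)"] \<open>finite A\<close> \<open>y \<in> A\<close> by blast
  have "covers L x m"
    unfolding covers_def
  proof (intro conjI notI)
    assume "\<exists>z\<in>carrier L. m \<sqsubset> z \<and> z \<sqsubset> x"
    then obtain z where z: "z \<in> carrier L" "m \<sqsubset> z" "z \<sqsubset> x"
      by blast
    then have "y \<sqsubseteq> z"
      using m(1) assms(2) le_trans[of y m z] by (auto simp: A_def lless_iff)
    with z have "z \<in> A"
      by (simp add: A_def)
    with z m(2) show False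
      by (auto simp: lless_iff)
  qed (use m assms in \<open>auto simp: A_def\<close>)
  with m(1) show ?thesis
    by (auto simp: A_def)
qed

lemma not_covers_bottom: "\<not> covers L \<bottom> y"
  using coversD[of \<bottom> y] bottom_lower le_antisym by blast

lemma ex_cover:
  assumes "x \<in> carrier L" "x \<noteq> \<bottom>"
  shows "\<exists>c. covers L x c"
  using ex_cover_above[of x \<bottom>] assms by (auto simp: lless_iff bottom_lower)

lemma join_irreducibles_iff:
  "x \<in> join_irreducibles L \<longleftrightarrow> (\<exists>!y. covers L x y)"
  using not_covers_bottom coversD(1) by (auto simp: join_irreducibles_def)

lemma covers_lower_cover:
  assumes "i \<in> join_irreducibles L"
  shows "covers L i (lower_cover L i)"
  using assms theI'[of "covers L i"] by (simp add: join_irreducibles_iff lower_cover_def)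

text \<open>Whatever lies strictly below \<open>i\<close> lies below some element covered by
  \<open>i\<close>, and there is only one such element.\<close>

lemma le_lower_cover:
  assumes "i \<in> join_irreducibles L" "y \<in> carrier L" "y \<sqsubset> i"
  shows "y \<sqsubseteq> lower_cover L i"
proof -
  have "i \<in> carrier L"
    using assms(1) by (simp add: join_irreducibles_def)
  with assms obtain c where "covers L i c" "y \<sqsubseteq> c"
    using ex_cover_above by blast
  with assms(1) covers_lower_cover show ?thesis
    unfolding join_irreducibles_iff by metis
qed

lemma lower_cover_neq_top:
  assumes "i \<in> join_irreducibles L"
  shows "lower_cover L i \<noteq> \<top>"
  using coversD[OF covers_lower_cover[OF assms]] top_higher le_antisym by metis

lemma finite_join_irreducibles: "finite (join_irreducibles L)"
  using finite_carrier by (simp add: join_irreducibles_def)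

text \<open>An atom, that is, a minimal element other than the bottom, covers the bottom and nothing
  else.\<close>

lemma join_irreducibles_nonempty:
  assumes "\<bottom> \<noteq> \<top>"
  shows "join_irreducibles L \<noteq> {}"
proof -
  define A where "A = carrier L - {\<bottom>}"
  have "finite A" "\<top> \<in> A"
    using assms finite_carrier by (auto simp: A_def)
  have "asymp_on A (\<sqsubset>)"
    by (rule asymp_onI) (auto simp: A_def lless_iff intro: le_antisym)
  moreover have "transp_on A (\<sqsubset>)"
    unfolding A_def transp_on_def using lless_trans by blast
  ultimately obtain a where a: "a \<in> A" "\<And>z. z \<in> A \<Longrightarrow> z \<noteq> a \<Longrightarrow> \<not> z \<sqsubset> a"
    using Finite_Set.bex_min_element[of A "(\<sqsubset>)"] \<open>finite A\<close> \<open>\<top> \<in> A\<close> by blast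
  have "y = \<bottom>" if "covers L a y" for y
    using a(2)[of y] coversD[OF that] by (auto simp: A_def lless_iff)
  moreover obtain c where "covers L a c"
    using a(1) ex_cover by (auto simp: A_def)
  ultimately have "a \<in> join_irreducibles L"
    unfolding join_irreducibles_iff by metis
  then show ?thesis
    by blast
qed

text \<open>By distributivity the numerator is the height of \<open>x\<close>. A one-element lattice
  has no join-irreducible elements, and division by zero then gives 0 even at the top; hence the
  assumption in \<open>rel_rank_top\<close>.\<close>

definition rel_rank :: "'a \<Rightarrow> real" where
  "rel_rank x = card {p \<in> join_irreducibles L. p \<sqsubseteq> x} / card (join_irreducibles L)"

lemma rel_rank_bottom: "rel_rank \<bottom> = 0"
proof -
  have "{p \<in> join_irreducibles L. p \<sqsubseteq> \<bottom>} = {}"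
    using le_antisym bottom_lower by (auto simp: join_irreducibles_def)
  then show ?thesis
    unfolding rel_rank_def by (simp only: card.empty of_nat_0 div_0)
qed

lemma rel_rank_top:
  assumes "\<bottom> \<noteq> \<top>"
  shows "rel_rank \<top> = 1"
proof -
  have "{p \<in> join_irreducibles L. p \<sqsubseteq> \<top>} = join_irreducibles L"
    using top_higher by (auto simp: join_irreducibles_def)
  then show ?thesis
    using join_irreducibles_nonempty[OF assms] finite_join_irreducibles
    by (simp add: rel_rank_def)
qed

text \<open>Passing from \<open>i\<close> down to its lower cover loses exactly one join-irreducible
  element, namely \<open>i\<close> itself. The jump is therefore the same for every
  \<open>i\<close>, which lets the contributions of an axis add up to 1.\<close>

lemma rel_rank_lower_cover:
  assumes "i \<in> join_irreducibles L"
  shows "rel_rank i - rel_rank (lower_cover L i) = 1 / card (join_irreducibles L)"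
proof -
  let ?c = "lower_cover L i"
  note c = coversD[OF covers_lower_cover[OF assms]]
  have "{p \<in> join_irreducibles L. p \<sqsubseteq> i} = insert i {p \<in> join_irreducibles L. p \<sqsubseteq> ?c}"
  proof (intro Set.set_eqI iffI)
    fix p assume "p \<in> {p \<in> join_irreducibles L. p \<sqsubseteq> i}"
    then show "p \<in> insert i {p \<in> join_irreducibles L. p \<sqsubseteq> ?c}"
      using le_lower_cover[OF assms, of p] by (auto simp: lless_iff join_irreducibles_def)
  next
    fix p assume "p \<in> insert i {p \<in> join_irreducibles L. p \<sqsubseteq> ?c}"
    then show "p \<in> {p \<in> join_irreducibles L. p \<sqsubseteq> i}"
      using assms c le_trans[of p ?c i] by (auto simp: join_irreducibles_def)
  qed
  moreover have "i \<notin> {p \<in> join_irreducibles L. p \<sqsubseteq> ?c}"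
    using c le_antisym by blast
  ultimately have "card {p \<in> join_irreducibles L. p \<sqsubseteq> i}
      = Suc (card {p \<in> join_irreducibles L. p \<sqsubseteq> ?c})"
    using finite_join_irreducibles by simp
  then show ?thesis
    by (simp add: rel_rank_def add_divide_distrib)
qed

end

section \<open>The product order: bounds, joins along an axis, and covers\<close>

locale lattice_family =
  fixes n :: nat and L :: "nat \<Rightarrow> 'a gorder"
  assumes lattices: "k \<in> {1..n} \<Longrightarrow> finite_distributive_lattice (L k)"
begin

abbreviation "P \<equiv> prod_order n L"

lemma carrier_prod: "carrier P = (\<Pi>\<^sub>E k\<in>{1..n}. carrier (L k))"
  and le_prod: "x \<sqsubseteq>\<^bsub>P\<^esub> y \<longleftrightarrow> (\<forall>k\<in>{1..n}. x k \<sqsubseteq>\<^bsub>L k\<^esub> y k)"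
  and lless_prod: "x \<sqsubset>\<^bsub>P\<^esub> y \<longleftrightarrow> (\<forall>k\<in>{1..n}. x k \<sqsubseteq>\<^bsub>L k\<^esub> y k) \<and> x \<noteq> y"
  by (simp_all add: prod_order_def lless_def)

lemma component_closed: "x \<in> carrier P \<Longrightarrow> k \<in> {1..n} \<Longrightarrow> x k \<in> carrier (L k)"
  by (auto simp: carrier_prod)

lemma prod_eqI:
  assumes "x \<in> carrier P" "y \<in> carrier P" "\<And>k. k \<in> {1..n} \<Longrightarrow> x k = y k"
  shows "x = y"
  using assms unfolding carrier_prod by (rule PiE_ext)

lemma update_closed:
  assumes "x \<in> carrier P" "j \<in> {1..n}" "a \<in> carrier (L j)"
  shows "x(j := a) \<in> carrier P"
  using assms by (auto simp: carrier_prod PiE_iff extensional_def)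

lemma component_refl:
  assumes "x \<in> carrier P" "k \<in> {1..n}"
  shows "x k \<sqsubseteq>\<^bsub>L k\<^esub> x k"
proof -
  interpret finite_distributive_lattice "L k"
    by (rule lattices[OF assms(2)])
  show ?thesis
    using component_closed[OF assms] by simp
qed

lemma component_antisym:
  assumes "k \<in> {1..n}" "a \<in> carrier (L k)" "b \<in> carrier (L k)" "a \<sqsubseteq>\<^bsub>L k\<^esub> b" "b \<sqsubseteq>\<^bsub>L k\<^esub> a"
  shows "a = b"
proof -
  interpret finite_distributive_lattice "L k"
    by (rule lattices[OF assms(1)])
  show ?thesis
    using assms by (intro le_antisym)
qed

lemma prod_antisym:
  assumes "x \<in> carrier P" "y \<in> carrier P" "x \<sqsubseteq>\<^bsub>P\<^esub> y" "y \<sqsubseteq>\<^bsub>P\<^esub> x"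
  shows "x = y"
  using assms component_closed component_antisym by (intro prod_eqI) (auto simp: le_prod)

lemma extremes:
  assumes "k \<in> {1..n}"
  shows "\<bottom>\<^bsub>L k\<^esub> \<in> carrier (L k)" "\<top>\<^bsub>L k\<^esub> \<in> carrier (L k)"
    and "\<And>a. a \<in> carrier (L k) \<Longrightarrow> \<bottom>\<^bsub>L k\<^esub> \<sqsubseteq>\<^bsub>L k\<^esub> a"
    and "\<And>a. a \<in> carrier (L k) \<Longrightarrow> a \<sqsubseteq>\<^bsub>L k\<^esub> \<top>\<^bsub>L k\<^esub>"
proof -
  interpret finite_distributive_lattice "L k"
    by (rule lattices[OF assms])
  show "\<bottom>\<^bsub>L k\<^esub> \<in> carrier (L k)" "\<top>\<^bsub>L k\<^esub> \<in> carrier (L k)"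
    and "\<And>a. a \<in> carrier (L k) \<Longrightarrow> \<bottom>\<^bsub>L k\<^esub> \<sqsubseteq>\<^bsub>L k\<^esub> a"
    and "\<And>a. a \<in> carrier (L k) \<Longrightarrow> a \<sqsubseteq>\<^bsub>L k\<^esub> \<top>\<^bsub>L k\<^esub>"
    by (simp_all add: bottom_lower top_higher)
qed

text \<open>The corners of the cube with sides bottom and top. Restricting to \<open>{1..n}\<close>
  makes them \<open>undefined\<close> elsewhere, as membership in the carrier of \<open>P\<close>
  demands.\<close>

definition vertex :: "nat set \<Rightarrow> nat \<Rightarrow> 'a" where
  "vertex S = (\<lambda>k\<in>{1..n}. if k \<in> S then \<top>\<^bsub>L k\<^esub> else \<bottom>\<^bsub>L k\<^esub>)"

lemma vertex_closed: "vertex S \<in> carrier P"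
  by (auto simp: vertex_def carrier_prod extremes)

text \<open>The bottom is picked by a choice operator, so uniqueness of a least element, a
  consequence of antisymmetry, is shown along with existence. The same pattern serves for the top
  and for joins.\<close>

lemma bottom_prod: "\<bottom>\<^bsub>P\<^esub> = vertex {}"
  unfolding bottom_def
proof (rule some_equality)
  show "least P (vertex {}) (carrier P)"
    unfolding least_def
  proof (intro conjI ballI)
    show "vertex {} \<sqsubseteq>\<^bsub>P\<^esub> x" if "x \<in> carrier P" for x
      using component_closed[OF that] by (simp add: le_prod vertex_def extremes)
  qed (simp_all add: vertex_closed)
  then show "x = vertex {}" if "least P x (carrier P)" for x
    using that prod_antisym unfolding least_def by blast
qed

lemma top_prod: "\<top>\<^bsub>P\<^esub> = vertex {1..n}"
  unfolding top_def
proof (rule some_equality)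
  show "greatest P (vertex {1..n}) (carrier P)"
    unfolding greatest_def
  proof (intro conjI ballI)
    show "x \<sqsubseteq>\<^bsub>P\<^esub> vertex {1..n}" if "x \<in> carrier P" for x
      using component_closed[OF that] by (simp add: le_prod vertex_def extremes)
  qed (simp_all add: vertex_closed)
  then show "x = vertex {1..n}" if "greatest P x (carrier P)" for x
    using that prod_antisym unfolding greatest_def by blast
qed

text \<open>The second argument is bottom off axis \<open>j\<close> and dominates \<open>x\<close>
  on it, so the join only raises coordinate \<open>j\<close> to \<open>a\<close>.\<close>

lemma join_axis:
  assumes "x \<in> carrier P" "j \<in> {1..n}" "a \<in> carrier (L j)" "x j \<sqsubseteq>\<^bsub>L j\<^esub> a"
  shows "x \<squnion>\<^bsub>P\<^esub> (vertex {})(j := a) = x(j := a)"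
  unfolding join_def sup_def
proof (rule some_equality)
  let ?i = "(vertex {})(j := a)"
  note closed = update_closed[OF vertex_closed assms(2,3), of "{}"] update_closed[OF assms(1-3)]
  show least: "least P (x(j := a)) (Upper P {x, ?i})"
  proof (rule least_UpperI)
    fix y assume "y \<in> {x, ?i}"
    then show "y \<sqsubseteq>\<^bsub>P\<^esub> x(j := a)"
      using assms component_refl[OF assms(1)] component_refl[OF closed(2), of j] component_closed[OF assms(1)]
      by (auto simp: le_prod vertex_def extremes split: if_splits)
  next
    fix y assume y: "y \<in> Upper P {x, ?i}"
    then have "x \<sqsubseteq>\<^bsub>P\<^esub> y" "?i \<sqsubseteq>\<^bsub>P\<^esub> y"
      using assms(1) closed by (auto simp: Upper_def)
    then show "x(j := a) \<sqsubseteq>\<^bsub>P\<^esub> y"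
      by (auto simp: le_prod split: if_splits)
  qed (use assms(1) closed in auto)
  show "z = x(j := a)" if "least P z (Upper P {x, ?i})" for z
  proof (rule prod_antisym)
    show "z \<in> carrier P" "x(j := a) \<in> carrier P"
      using that closed by auto
    show "z \<sqsubseteq>\<^bsub>P\<^esub> x(j := a)" "x(j := a) \<sqsubseteq>\<^bsub>P\<^esub> z"
      using least_le[OF that least_mem[OF least]] least_le[OF least least_mem[OF that]] .
  qed
qed

text \<open>An element strictly between is squeezed to agree with \<open>x\<close> off axis
  \<open>j\<close>, so its coordinate \<open>j\<close> would lie strictly between \<open>c\<close>
  and \<open>x j\<close>.\<close>

lemma covers_prod_update:
  assumes "x \<in> carrier P" "j \<in> {1..n}" "covers (L j) (x j) c"
  shows "covers P x (x(j := c))"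
proof -
  interpret Lj: finite_distributive_lattice "L j"
    by (rule lattices[OF assms(2)])
  note c = Lj.coversD[OF assms(3)]
  have closed: "x(j := c) \<in> carrier P"
    using assms c by (intro update_closed)
  have "False" if z: "z \<in> carrier P" "x(j := c) \<sqsubset>\<^bsub>P\<^esub> z" "z \<sqsubset>\<^bsub>P\<^esub> x" for z
  proof -
    have "z k = x k" if "k \<in> {1..n}" "k \<noteq> j" for k
    proof (rule component_antisym[OF that(1)])
      show "z k \<in> carrier (L k)" "x k \<in> carrier (L k)"
        using that(1) z(1) assms(1) by (auto intro: component_closed)
      show "z k \<sqsubseteq>\<^bsub>L k\<^esub> x k"
        using that(1) z(3) by (simp add: lless_prod)
      have "(x(j := c)) k \<sqsubseteq>\<^bsub>L k\<^esub> z k"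
        using that(1) z(2) unfolding lless_prod by blast
      with that(2) show "x k \<sqsubseteq>\<^bsub>L k\<^esub> z k"
        by simp
    qed
    then have "z j \<noteq> c" "z j \<noteq> x j"
      using z closed assms(1) prod_eqI[OF z(1) closed] prod_eqI[OF z(1) assms(1)]
      by (auto simp: lless_prod)
    moreover have "(x(j := c)) j \<sqsubseteq>\<^bsub>L j\<^esub> z j" "z j \<sqsubseteq>\<^bsub>L j\<^esub> x j"
      using z(2,3) assms(2) unfolding lless_prod by blast+
    ultimately show False
      using assms(3) component_closed[OF z(1) assms(2)] by (auto simp: covers_def Lj.lless_iff)
  qed
  moreover have "x(j := c) \<sqsubset>\<^bsub>P\<^esub> x"
    using c component_refl[OF assms(1)] by (auto simp: lless_prod fun_eq_iff)
  ultimately show ?thesis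
    using assms closed unfolding covers_def by blast
qed

text \<open>Converse of the previous lemma: a cover in the product changes a single coordinate,
  since changing only one of the differing coordinates already gives an element between
  \<open>y\<close> and \<open>x\<close>.\<close>

lemma covers_prodE:
  assumes "covers P x y"
  obtains j where "j \<in> {1..n}" "covers (L j) (x j) (y j)" "y = x(j := y j)"
proof -
  have x: "x \<in> carrier P" and y: "y \<in> carrier P" and less: "y \<sqsubset>\<^bsub>P\<^esub> x"
    and between: "\<And>z. z \<in> carrier P \<Longrightarrow> y \<sqsubset>\<^bsub>P\<^esub> z \<Longrightarrow> z \<sqsubset>\<^bsub>P\<^esub> x \<Longrightarrow> False"
    using assms unfolding covers_def by blast+
  obtain j where j: "j \<in> {1..n}" "y j \<noteq> x j"
    using less prod_eqI[OF y x] by (auto simp: lless_prod)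
  interpret Lj: finite_distributive_lattice "L j"
    by (rule lattices[OF j(1)])
  have closed: "x(j := z) \<in> carrier P" if "z \<in> carrier (L j)" for z
    using x j(1) that by (rule update_closed)
  have below: "x(j := z) \<sqsubset>\<^bsub>P\<^esub> x" if "z \<sqsubset>\<^bsub>L j\<^esub> x j" for z
    using that component_refl[OF x] by (auto simp: lless_prod Lj.lless_iff fun_eq_iff)
  have above: "y \<sqsubseteq>\<^bsub>P\<^esub> x(j := z)" if "y j \<sqsubseteq>\<^bsub>L j\<^esub> z" for z
    using that less by (auto simp: le_prod lless_prod)
  have yj: "y j \<in> carrier (L j)" "y j \<sqsubset>\<^bsub>L j\<^esub> x j"
    using y less j component_closed by (auto simp: lless_prod Lj.lless_iff)
  \<comment> \<open>The element \<open>x(j := y j)\<close> is above \<open>y\<close> and strictly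
    below \<open>x\<close>; with nothing strictly between, it must be \<open>y\<close>.\<close>
  have eq: "y = x(j := y j)"
    using between[OF closed[OF yj(1)]] above[of "y j"] below[OF yj(2)] yj(1)
    by (auto simp: lless_prod le_prod)
  have "covers (L j) (x j) (y j)"
    unfolding covers_def
  proof (intro conjI notI)
    assume "\<exists>z\<in>carrier (L j). y j \<sqsubset>\<^bsub>L j\<^esub> z \<and> z \<sqsubset>\<^bsub>L j\<^esub> x j"
    then obtain z where z: "z \<in> carrier (L j)" "y j \<sqsubset>\<^bsub>L j\<^esub> z" "z \<sqsubset>\<^bsub>L j\<^esub> x j"
      by blast
    then have "y \<sqsubset>\<^bsub>P\<^esub> x(j := z)"
      using above[of z] by (auto simp: Lj.lless_iff lless_prod le_prod)
    with z show False
      using between closed below by blast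
  qed (use x y j yj component_closed in auto)
  with that j(1) eq show thesis
    by blast
qed

section \<open>Join-irreducible elements of the product\<close>

definition axis_elem :: "nat \<times> 'a \<Rightarrow> nat \<Rightarrow> 'a" where
  "axis_elem = (\<lambda>(j, a). (vertex {})(j := a))"

text \<open>The bottom of a factor covers nothing, so a cover can only lower coordinate
  \<open>j\<close>, and there it is unique.\<close>

lemma axis_elem_join_irreducible:
  assumes "j \<in> {1..n}" "a \<in> join_irreducibles (L j)"
  shows "axis_elem (j, a) \<in> join_irreducibles P"
proof -
  interpret Lj: finite_distributive_lattice "L j"
    by (rule lattices[OF assms(1)])
  let ?x = "axis_elem (j, a)" and ?c = "lower_cover (L j) a"
  have a: "a \<in> carrier (L j)" "a \<noteq> \<bottom>\<^bsub>L j\<^esub>"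
    using assms(2) by (auto simp: join_irreducibles_def)
  have x: "?x \<in> carrier P"
    using a assms(1) by (auto simp: axis_elem_def intro: update_closed vertex_closed)
  have cover: "covers P ?x (?x(j := ?c))"
    using x assms Lj.covers_lower_cover by (intro covers_prod_update) (auto simp: axis_elem_def)
  have "y = ?x(j := ?c)" if "covers P ?x y" for y
    using that
  proof (rule covers_prodE)
    fix k assume k: "k \<in> {1..n}" "covers (L k) (?x k) (y k)" "y = ?x(k := y k)"
    interpret Lk: finite_distributive_lattice "L k"
      by (rule lattices[OF k(1)])
    have "k = j"
      using k Lk.not_covers_bottom by (auto simp: axis_elem_def vertex_def split: if_splits)
    moreover from this have "y k = ?c"
      using k(2) assms(2) Lj.covers_lower_cover
      unfolding Lj.join_irreducibles_iff by (auto simp: axis_elem_def)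
    ultimately show ?thesis
      using k(3) by metis
  qed
  with cover have "\<exists>!y. covers P ?x y"
    by blast
  moreover have "?x j \<noteq> \<bottom>\<^bsub>P\<^esub> j"
    using a assms(1) by (simp add: axis_elem_def bottom_prod vertex_def)
  ultimately show ?thesis
    using x unfolding join_irreducibles_def by auto
qed

text \<open>If two coordinates were different from bottom, lowering either one would give two
  different elements covered by \<open>x\<close>.\<close>

lemma join_irreducible_axis_elem:
  assumes "x \<in> join_irreducibles P"
  obtains j a where "j \<in> {1..n}" "a \<in> join_irreducibles (L j)" "x = axis_elem (j, a)"
proof -
  have x: "x \<in> carrier P"
    using assms by (simp add: join_irreducibles_def)
  obtain y where y: "covers P x y" "\<And>z. covers P x z \<Longrightarrow> z = y"
    using assms by (auto simp: join_irreducibles_def)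
  from y(1) obtain j where j: "j \<in> {1..n}" "covers (L j) (x j) (y j)" "y = x(j := y j)"
    by (rule covers_prodE)
  interpret Lj: finite_distributive_lattice "L j"
    by (rule lattices[OF j(1)])
  have "c = y j" if "covers (L j) (x j) c" for c
    using y(2)[OF covers_prod_update[OF x j(1) that]] by auto
  with j(2) have ji: "x j \<in> join_irreducibles (L j)"
    unfolding Lj.join_irreducibles_iff by blast
  have "x k = \<bottom>\<^bsub>L k\<^esub>" if k: "k \<in> {1..n}" "k \<noteq> j" for k
  proof (rule ccontr)
    assume "x k \<noteq> \<bottom>\<^bsub>L k\<^esub>"
    interpret Lk: finite_distributive_lattice "L k"
      by (rule lattices[OF k(1)])
    obtain c where c: "covers (L k) (x k) c"
      using Lk.ex_cover component_closed[OF x k(1)] \<open>x k \<noteq> \<bottom>\<^bsub>L k\<^esub>\<close> by blast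
    \<comment> \<open>By uniqueness \<open>x(k := c)\<close> is \<open>y\<close>; but the former
      keeps \<open>x j\<close>, while \<open>y j\<close> lies strictly below it.\<close>
    have "(x(k := c)) j = y j"
      using y(2)[OF covers_prod_update[OF x k(1) c]] by simp
    with k(2) Lj.coversD(4)[OF j(2)] show False
      by auto
  qed
  moreover have "axis_elem (j, x j) \<in> carrier P"
    using axis_elem_join_irreducible[OF j(1) ji] by (simp add: join_irreducibles_def)
  ultimately have "x = axis_elem (j, x j)"
    using x by (intro prod_eqI) (auto simp: axis_elem_def vertex_def)
  with that j(1) ji show thesis
    by blast
qed

text \<open>Turns the sum over the join-irreducible elements of the product into a double sum over
  axes and factors. Injectivity holds because the axis is the only coordinate that is not
  bottom.\<close>

lemma bij_betw_axis_elem: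
  "bij_betw axis_elem (SIGMA j:{1..n}. join_irreducibles (L j)) (join_irreducibles P)"
  unfolding bij_betw_def
proof
  show "inj_on axis_elem (SIGMA j:{1..n}. join_irreducibles (L j))"
  proof (rule inj_onI, clarify)
    fix j a k b
    assume *: "j \<in> {1..n}" "a \<in> join_irreducibles (L j)" "k \<in> {1..n}" "b \<in> join_irreducibles (L k)"
      and eq: "axis_elem (j, a) = axis_elem (k, b)"
    have "j = k"
      using * fun_cong[OF eq, of j]
      by (auto simp: axis_elem_def vertex_def join_irreducibles_def split: if_splits)
    with eq show "j = k \<and> a = b"
      by (auto simp: axis_elem_def dest: fun_cong[of _ _ j])
  qed
  show "axis_elem ` (SIGMA j:{1..n}. join_irreducibles (L j)) = join_irreducibles P"
  proof (intro equalityI subsetI)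
    fix x assume "x \<in> join_irreducibles P"
    then obtain j a where "j \<in> {1..n}" "a \<in> join_irreducibles (L j)" "x = axis_elem (j, a)"
      by (rule join_irreducible_axis_elem)
    then show "x \<in> axis_elem ` (SIGMA j:{1..n}. join_irreducibles (L j))"
      by blast
  qed (auto intro: axis_elem_join_irreducible)
qed

text \<open>The multilinear extension, in the relative ranks, of the indicator of the corner
  \<open>vertex S\<close>.\<close>

definition test_fun :: "nat set \<Rightarrow> (nat \<Rightarrow> 'a) \<Rightarrow> real" where
  "test_fun S x = (\<Prod>l\<in>{1..n}.
     let r = finite_distributive_lattice.rel_rank (L l) (x l) in if l \<in> S then r else 1 - r)"

end

section \<open>Importance values of the test functions when every factor has distinct bounds\<close>

locale nontrivial_lattice_family = lattice_family +
  assumes nontrivial: "k \<in> {1..n} \<Longrightarrow> \<bottom>\<^bsub>L k\<^esub> \<noteq> \<top>\<^bsub>L k\<^esub>"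
begin

lemma rel_rank_extremes:
  assumes "k \<in> {1..n}"
  shows "finite_distributive_lattice.rel_rank (L k) \<bottom>\<^bsub>L k\<^esub> = 0"
    and "finite_distributive_lattice.rel_rank (L k) \<top>\<^bsub>L k\<^esub> = 1"
  using finite_distributive_lattice.rel_rank_bottom[OF lattices[OF assms]]
    finite_distributive_lattice.rel_rank_top[OF lattices[OF assms] nontrivial[OF assms]] by auto

text \<open>At bottom and top the relative rank is 0 and 1, so each factor is an indicator. The
  index set \<open>A\<close> is arbitrary because both the full product and the product without axis
  \<open>j\<close> are required.\<close>

lemma prod_test_vertex:
  assumes "A \<subseteq> {1..n}" "\<And>k. k \<in> A \<Longrightarrow> x k \<in> {\<bottom>\<^bsub>L k\<^esub>, \<top>\<^bsub>L k\<^esub>}"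
  shows "(\<Prod>l\<in>A. let r = finite_distributive_lattice.rel_rank (L l) (x l) in
            if l \<in> S then r else 1 - r)
         = of_bool (\<forall>k\<in>A. x k = vertex S k)"
proof -
  have "(\<Prod>l\<in>A. let r = finite_distributive_lattice.rel_rank (L l) (x l) in
            if l \<in> S then r else 1 - r)
        = (\<Prod>l\<in>A. of_bool (x l = vertex S l))"
  proof (rule prod.cong)
    fix l assume "l \<in> A"
    with assms have "l \<in> {1..n}" "x l = \<bottom>\<^bsub>L l\<^esub> \<or> x l = \<top>\<^bsub>L l\<^esub>"
      by auto
    then show "(let r = finite_distributive_lattice.rel_rank (L l) (x l) in
            if l \<in> S then r else 1 - r) = of_bool (x l = vertex S l)"
      using rel_rank_extremes[of l] nontrivial[of l] by (auto simp: vertex_def Let_def)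
  qed simp
  also have "\<dots> = of_bool (\<forall>k\<in>A. x k = vertex S k)"
  proof -
    have "finite A"
      using assms(1) finite_subset by blast
    then show ?thesis
      by (induction rule: finite_induct) auto
  qed
  finally show ?thesis .
qed

lemma test_fun_vertex:
  assumes "S \<subseteq> {1..n}" "T \<subseteq> {1..n}"
  shows "test_fun S (vertex T) = of_bool (S = T)"
proof -
  have "test_fun S (vertex T) = of_bool (\<forall>k\<in>{1..n}. vertex T k = vertex S k)"
    unfolding test_fun_def by (rule prod_test_vertex) (auto simp: vertex_def)
  moreover have "(\<forall>k\<in>{1..n}. vertex T k = vertex S k) \<longleftrightarrow> S = T"
  proof
    assume eq: "\<forall>k\<in>{1..n}. vertex T k = vertex S k"
    have "k \<in> S \<longleftrightarrow> k \<in> T" if "k \<in> {1..n}" for k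
      using bspec[OF eq that] nontrivial[OF that] that by (auto simp: vertex_def split: if_splits)
    with assms show "S = T"
      by blast
  qed simp
  ultimately show ?thesis
    by simp
qed

text \<open>The factors off axis \<open>j\<close> vanish unless \<open>x\<close> agrees there with
  \<open>vertex S\<close>, which leaves the single term \<open>x0\<close>. Its factor on axis
  \<open>j\<close> changes by the constant jump of the relative rank, with a sign.\<close>

lemma importance_test_fun:
  assumes "S \<subseteq> {1..n}" "j \<in> {1..n}" "a \<in> join_irreducibles (L j)"
  shows "importance n L \<alpha> (test_fun S) (axis_elem (j, a))
    = (if j \<in> S then \<alpha> (card S - 1) else - \<alpha> (card S)) / card (join_irreducibles (L j))"
proof -
  interpret Lj: finite_distributive_lattice "L j"
    by (rule lattices[OF assms(2)])
  let ?c = "lower_cover (L j) a" and ?N = "real (card (join_irreducibles (L j)))"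
  let ?f = "\<lambda>x l. let r = finite_distributive_lattice.rel_rank (L l) (x l) in
              if l \<in> S then r else 1 - r"
  define X where "X = {x \<in> carrier P. x j = ?c \<and>
                 (\<forall>k\<in>{1..n} - {j}. x k \<in> {\<bottom>\<^bsub>L k\<^esub>, \<top>\<^bsub>L k\<^esub>})}"
  define x0 where "x0 = (vertex S)(j := ?c)"
  \<comment> \<open>The factor on axis \<open>j\<close> is the relative rank if \<open>j\<close> is
    in \<open>S\<close>, and 1 minus it otherwise.\<close>
  define s :: real where "s = (if j \<in> S then 1 else - 1)"
  note c = Lj.coversD[OF Lj.covers_lower_cover[OF assms(3)]]
  have axis: "axis n L (axis_elem (j, a)) = j"
    using assms(2,3) by (intro axis_unique) (auto simp: axis_elem_def vertex_def)
  have "x0 \<in> X"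
    using update_closed[OF vertex_closed assms(2) c(2), of S]
    by (simp add: X_def x0_def) (simp add: vertex_def)
  have "finite X"
  proof (rule finite_subset)
    show "X \<subseteq> carrier P"
      by (auto simp: X_def)
    show "finite (carrier P)"
      unfolding carrier_prod
      using lattices finite_distributive_lattice.finite_carrier by (intro finite_PiE) auto
  qed
  have diff: "test_fun S (x \<squnion>\<^bsub>P\<^esub> axis_elem (j, a)) - test_fun S x = of_bool (x = x0) * (s / ?N)"
    if "x \<in> X" for x
  proof -
    have x: "x \<in> carrier P" "x j = ?c"
      using that by (auto simp: X_def)
    have "x \<squnion>\<^bsub>P\<^esub> axis_elem (j, a) = x(j := a)"
      using x c assms(2) by (auto simp: axis_elem_def intro: join_axis)
    moreover have split: "test_fun S y = ?f y j * (\<Prod>l\<in>{1..n} - {j}. ?f y l)" for y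
      unfolding test_fun_def using assms(2) by (intro prod.remove) auto
    moreover have "(\<Prod>l\<in>{1..n} - {j}. ?f (x(j := a)) l) = (\<Prod>l\<in>{1..n} - {j}. ?f x l)"
      by (intro prod.cong) auto
    ultimately have "test_fun S (x \<squnion>\<^bsub>P\<^esub> axis_elem (j, a)) - test_fun S x
      = (?f (x(j := a)) j - ?f x j) * (\<Prod>l\<in>{1..n} - {j}. ?f x l)"
      by (simp add: left_diff_distrib)
    also have "?f (x(j := a)) j - ?f x j = s / ?N"
      using Lj.rel_rank_lower_cover[OF assms(3)] x by (auto simp: s_def Let_def)
    also have "(\<Prod>l\<in>{1..n} - {j}. ?f x l) = of_bool (\<forall>k\<in>{1..n} - {j}. x k = vertex S k)"
      using that by (intro prod_test_vertex) (auto simp: X_def)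
    also have "(\<forall>k\<in>{1..n} - {j}. x k = vertex S k) \<longleftrightarrow> x = x0"
    proof
      assume "\<forall>k\<in>{1..n} - {j}. x k = vertex S k"
      with x \<open>x0 \<in> X\<close> show "x = x0"
        by (intro prod_eqI) (auto simp: X_def x0_def)
    qed (auto simp: x0_def)
    finally show ?thesis
      by (simp add: mult.commute)
  qed
  \<comment> \<open>Coordinate \<open>j\<close> of \<open>x0\<close> is a lower cover and hence
    never top, so \<open>j\<close> is not counted even if it belongs to \<open>S\<close>.\<close>
  have "{l \<in> {1..n}. x0 l = \<top>\<^bsub>L l\<^esub>} = S - {j}"
    using assms(1,2) nontrivial Lj.lower_cover_neq_top[OF assms(3)]
    by (auto simp: x0_def vertex_def split: if_splits)
  then have count: "top_count n L x0 = (if j \<in> S then card S - 1 else card S)"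
    by (simp add: top_count_def)
  have "importance n L \<alpha> (test_fun S) (axis_elem (j, a))
    = (\<Sum>x\<in>X. \<alpha> (top_count n L x) * (test_fun S (x \<squnion>\<^bsub>P\<^esub> axis_elem (j, a)) - test_fun S x))"
    unfolding importance_def axis X_def by (simp add: axis_elem_def)
  also have "\<dots> = (\<Sum>x\<in>X. if x = x0 then \<alpha> (top_count n L x) * (s / ?N) else 0)"
    by (intro sum.cong) (simp_all add: diff)
  also have "\<dots> = \<alpha> (top_count n L x0) * (s / ?N)"
    using \<open>finite X\<close> \<open>x0 \<in> X\<close> by simp
  finally show ?thesis
    by (simp add: count s_def)
qed

text \<open>Each axis contributes its coefficient once, whatever the size of its factor. At the
  extremes, the truncated \<open>card S - 1\<close> for empty \<open>S\<close> and the unconstrained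
  \<open>\<alpha> n\<close> for full \<open>S\<close> are both multiplied by 0.\<close>

lemma sum_importance_test_fun:
  fixes \<alpha> :: "nat \<Rightarrow> real"
  assumes "S \<subseteq> {1..n}"
  shows "(\<Sum>i\<in>join_irreducibles P. importance n L \<alpha> (test_fun S) i)
    = card S * \<alpha> (card S - 1) - real (n - card S) * \<alpha> (card S)"
proof -
  let ?J = "\<lambda>j. join_irreducibles (L j)"
  let ?b = "\<lambda>j. if j \<in> S then \<alpha> (card S - 1) else - \<alpha> (card S)"
  have J: "finite (?J j)" "?J j \<noteq> {}" if "j \<in> {1..n}" for j
    using that lattices nontrivial finite_distributive_lattice.finite_join_irreducibles
      finite_distributive_lattice.join_irreducibles_nonempty by auto
  have "(\<Sum>i\<in>join_irreducibles P. importance n L \<alpha> (test_fun S) i)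
    = (\<Sum>p\<in>(SIGMA j:{1..n}. ?J j). importance n L \<alpha> (test_fun S) (axis_elem p))"
    using sum.reindex_bij_betw[OF bij_betw_axis_elem] by metis
  also have "\<dots> = (\<Sum>j\<in>{1..n}. \<Sum>a\<in>?J j. importance n L \<alpha> (test_fun S) (axis_elem (j, a)))"
    using J by (subst sum.Sigma) auto
  also have "\<dots> = (\<Sum>j\<in>{1..n}. \<Sum>a\<in>?J j. ?b j / card (?J j))"
    using assms by (intro sum.cong refl importance_test_fun)
  \<comment> \<open>The number of summands cancels the denominator, which is nonzero because a
    nontrivial factor has a join-irreducible element.\<close>
  also have "\<dots> = (\<Sum>j\<in>{1..n}. ?b j)"
    using J by (intro sum.cong) auto
  also have "\<dots> = (\<Sum>j\<in>{1..n} \<inter> S. \<alpha> (card S - 1)) + (\<Sum>j\<in>{1..n} - S. - \<alpha> (card S))"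
    by (simp add: sum.If_cases Diff_eq)
  also have "{1..n} \<inter> S = S"
    using assms by blast
  also have "card ({1..n} - S) = n - card S"
    using assms by (simp add: card_Diff_subset finite_subset)
  then have "(\<Sum>j\<in>{1..n} - S. - \<alpha> (card S)) = - (real (n - card S) * \<alpha> (card S))"
    by simp
  finally show ?thesis
    by simp
qed

end

section \<open>Solving the recursion for the coefficients\<close>

lemma shapley_recursion_unique:
  fixes \<alpha> :: "nat \<Rightarrow> real"
  assumes rec: "\<And>m. 1 \<le> m \<Longrightarrow> m \<le> n \<Longrightarrow>
      m * \<alpha> (m - 1) - real (n - m) * \<alpha> m = of_bool (m = n)"
    and "k < n"
  shows "\<alpha> k = fact (n - 1 - k) * fact k / fact n"
proof -
  have "k \<le> n - 1"
    using assms(2) by simp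
  then show ?thesis
  \<comment> \<open>Descending induction from \<open>n - 1\<close>: the case \<open>m = n\<close> of
    the recursion gives the starting value, and every smaller \<open>m\<close> expresses
    \<open>\<alpha> (m - 1)\<close> through \<open>\<alpha> m\<close>.\<close>
  proof (induction rule: inc_induct)
    case base
    have "(fact n :: real) = n * fact (n - 1)"
      using assms(2) by (simp add: fact_reduce)
    moreover have "n * \<alpha> (n - 1) = 1"
      using rec[of n] assms(2) by simp
    ultimately have "fact n * \<alpha> (n - 1) = fact (n - 1)"
      by (simp add: mult.commute mult.left_commute)
    then show ?case
      by (simp add: field_simps)
  next
    case (step m)
    \<comment> \<open>Here \<open>m < n - 1\<close>, so the subtraction is exact; writing
      \<open>n = m + d + 2\<close> removes truncated subtraction from the computation.\<close>
    define d where "d = n - m - 2"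
    with step have n: "n = m + d + 2"
      by simp
    \<comment> \<open>The recursion at \<open>m + 1\<close>, which is still below \<open>n\<close>,
      so its right-hand side is 0.\<close>
    have "(m + 1) * \<alpha> m = (d + 1) * \<alpha> (m + 1)"
      using rec[of "m + 1"] by (simp add: n algebra_simps)
    also have "\<dots> = (d + 1) * (fact d * fact (m + 1) / fact n)"
      using step.IH by (simp add: n)
    also have "\<dots> = (m + 1) * (fact (d + 1) * fact m / fact n)"
      by (simp add: field_simps)
    finally have "real (m + 1) * \<alpha> m = real (m + 1) * (fact (d + 1) * fact m / fact n)" .
    then have "\<alpha> m = fact (d + 1) * fact m / fact n"
      by (subst (asm) mult_left_cancel) simp_all
    then show ?case
      by (simp add: n)
  qed
qed

section \<open>The efficiency identity evaluated at the test functions\<close>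

theorem theorem4:
  fixes n :: nat
    and L :: "nat \<Rightarrow> 'a gorder"
    and \<alpha> :: "nat \<Rightarrow> real"
  assumes "n \<ge> 1"
    and "\<And>k. k \<in> {1..n} \<Longrightarrow> finite_distributive_lattice (L k)"
    and "\<And>k. k \<in> {1..n} \<Longrightarrow> \<bottom>\<^bsub>L k\<^esub> \<noteq> \<top>\<^bsub>L k\<^esub>"
    and "\<And>v :: (nat \<Rightarrow> 'a) \<Rightarrow> real.
           (\<Sum>i \<in> join_irreducibles (prod_order n L). importance n L \<alpha> v i)
             = v \<top>\<^bsub>prod_order n L\<^esub> - v \<bottom>\<^bsub>prod_order n L\<^esub>"
  shows "\<forall>k \<in> {0..n - 1}. \<alpha> k = fact (n - 1 - k) * fact k / fact n"
proof
  interpret nontrivial_lattice_family n L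
    by (intro nontrivial_lattice_family.intro lattice_family.intro
        nontrivial_lattice_family_axioms.intro assms(2,3))
  have rec: "m * \<alpha> (m - 1) - real (n - m) * \<alpha> m = of_bool (m = n)" if m: "1 \<le> m" "m \<le> n" for m
  proof -
    \<comment> \<open>Only the size of the index set enters the summed identity, so an initial
      segment represents all sets of size \<open>m\<close>.\<close>
    have S: "{1..m} \<subseteq> {1..n}"
      using m by auto
    have "m * \<alpha> (m - 1) - real (n - m) * \<alpha> m
      = test_fun {1..m} (vertex {1..n}) - test_fun {1..m} (vertex {})"
      using sum_importance_test_fun[OF S, of \<alpha>] assms(4)[of "test_fun {1..m}"]
      by (simp add: top_prod bottom_prod)
    \<comment> \<open>The value at the bottom vanishes because \<open>m \<ge> 1\<close>; the value
      at the top is 1 exactly if the segment is all of \<open>{1..n}\<close>.\<close>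
    also have "\<dots> = of_bool (m = n)"
      using m S by (auto simp: test_fun_vertex)
    finally show ?thesis .
  qed
  fix k assume "k \<in> {0..n - 1}"
  with assms(1) show "\<alpha> k = fact (n - 1 - k) * fact k / fact n"
    using shapley_recursion_unique[of n \<alpha> k, OF rec] by simp
qed

end
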